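(* Let $a,b$ be positive integers and let $n=ab$. Let $\rho'(a,b)$ denote the number of pairs $(x,y)$ of integers such that $x>1$, $y>1$ and $xy\mid ax+by-1$. Then for every integer $n\ge1$ and every real number $\alpha$ with $1\le\alpha\le\sqrt n$, $$\rho'(a,b)<\frac1\alpha\sqrt n\,\log n+2\left(1+\frac{0.6}{\alpha}\right)\sqrt n+\frac{2(2n-1)\alpha}{2\sqrt n-\alpha}.$$
   Context: $\log$ is the natural logarithm. *)

theory Defs
  imports Complex_Main
begin

definition rho' :: "int \<Rightarrow> int \<Rightarrow> nat" where
  "rho' a b = card {(x :: int, y :: int). x > 1 \<and> y > 1 \<and> x * y dvd a * x + b * y - 1}"

text \<open>Since \<open>card\<close> is 0 on infinite sets, we check that the set being counted is finite.\<close>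

lemma finite_rho'_set:
  fixes a b :: int
  assumes "a > 0" and "b > 0"
  shows "finite {(x :: int, y :: int). x > 1 \<and> y > 1 \<and> x * y dvd a * x + b * y - 1}"
    (is "finite ?S")
proof -
  define M where "M = a * b + a + b"
  have y_le: "y \<le> a * x" and x_le: "x \<le> b * y" and mn: "x \<le> M \<or> y \<le> M"
    if "x > 1" "y > 1" "x * y dvd a * x + b * y - 1" for x y :: int
  proof -
    have ax: "a * x \<ge> x" and "b * y \<ge> y"
      using assms that by simp_all
    then have pos: "a * x > 1" "b * y > 1" using that by linarith+
    have "y dvd (a * x - 1) + b * y" "x dvd (b * y - 1) + a * x"
      using that(3) by (auto simp: algebra_simps intro: dvd_mult_left dvd_mult_right)
    then have "y dvd a * x - 1" "x dvd b * y - 1"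
      by (simp_all add: dvd_add_left_iff)
    with pos show "y \<le> a * x" "x \<le> b * y"
      using zdvd_imp_le by fastforce+
    have "x * y \<le> a * x + b * y - 1"
      using that(3) pos by (intro zdvd_imp_le) auto
    then have le: "(x - b) * (y - a) < a * b"
      by (simp add: algebra_simps)
    show "x \<le> M \<or> y \<le> M"
    proof (rule ccontr)
      assume "\<not> ?thesis"
      then have g: "x - b > a * b" "y - a \<ge> 1"
        using assms mult_pos_pos[OF assms] unfolding M_def by linarith+
      have "a * b * 1 \<le> (x - b) * (y - a)"
        using g mult_pos_pos[OF assms] by (intro mult_mono) linarith+
      with le show False by simp
    qed
  qed
  have "?S \<subseteq> {0..M + b * M} \<times> {0..M + a * M}"
  proof clarify
    fix x y :: int
    assume *: "x > 1" "y > 1" "x * y dvd a * x + b * y - 1"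
    have M: "M > 0" using assms mult_pos_pos[OF assms] unfolding M_def by linarith
    then have M': "0 < a * M" "0 < b * M" using assms by simp_all
    have "x \<le> M \<Longrightarrow> a * x \<le> a * M" "y \<le> M \<Longrightarrow> b * y \<le> b * M"
      using assms by simp_all
    then show "x \<in> {0..M + b * M} \<and> y \<in> {0..M + a * M}"
      using y_le[OF *] x_le[OF *] mn[OF *] * M M' by auto
  qed
  then show ?thesis by (rule finite_subset) simp
qed

end

theory Submission
  imports Defs
begin

text \<open>
  For a solution put \<open>a x + b y - 1 = k x y\<close>, \<open>r = k x - b\<close> and \<open>s = k y - a\<close>. Then \<open>r y = a x - 1\<close>,
  \<open>s x = b y - 1\<close> and \<open>r s = n - k\<close>, so \<open>r\<close> or \<open>s\<close> is below \<open>w = sqrt n\<close>; by symmetry let \<open>b \<le> a\<close>.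
  Solutions with \<open>k \<le> w / \<alpha>\<close> are counted by pairs \<open>(r, k)\<close> or \<open>(s, k)\<close> with \<open>k\<close> in a fixed residue
  class modulo \<open>r\<close> or \<open>s\<close>, which gives a harmonic sum and hence the logarithm.
  If \<open>k > w / \<alpha>\<close> and \<open>r < w\<close>, then \<open>x < 2 \<alpha>\<close> and \<open>r\<close> lies in a fixed class modulo \<open>x\<close>.
  If \<open>k > w / \<alpha>\<close> and \<open>s < w\<close>, then \<open>y < \<alpha> (w / b + 1)\<close>, \<open>s\<close> lies in a fixed class modulo \<open>y\<close>,
  and \<open>s \<le> (b y - 1) / 2\<close> because \<open>x \<ge> 2\<close>.
\<close>

section \<open>Solutions and their complementary factors\<close>

definition sols :: "int \<Rightarrow> int \<Rightarrow> (int \<times> int) set" where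
  "sols a b = {(x, y). x > 1 \<and> y > 1 \<and> x * y dvd a * x + b * y - 1}"

text \<open>The division is exact on solutions, where the value is the multiplier
  \<open>k\<close>.\<close>

definition quot :: "int \<Rightarrow> int \<Rightarrow> int \<times> int \<Rightarrow> int" where
  "quot a b = (\<lambda>(x, y). (a * x + b * y - 1) div (x * y))"

definition rfac :: "int \<Rightarrow> int \<Rightarrow> int \<times> int \<Rightarrow> int" where
  "rfac a b = (\<lambda>(x, y). quot a b (x, y) * x - b)"

definition sfac :: "int \<Rightarrow> int \<Rightarrow> int \<times> int \<Rightarrow> int" where
  "sfac a b = (\<lambda>(x, y). quot a b (x, y) * y - a)"

lemma finite_sols: "a > 0 \<Longrightarrow> b > 0 \<Longrightarrow> finite (sols a b)"
  unfolding sols_def by (rule finite_rho'_set)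

lemma rho'_sols: "rho' a b = card (sols a b)"
  unfolding rho'_def sols_def ..

lemma sols_swap: "sols b a = prod.swap ` sols a b"
  unfolding sols_def by (auto simp: image_iff algebra_simps)

lemma rho'_commute: "rho' a b = rho' b a"
  unfolding rho'_sols sols_swap[of b a] by (simp add: card_image)

lemma quot_swap: "quot b a (y, x) = quot a b (x, y)"
  by (simp add: quot_def algebra_simps)

lemma rfac_swap: "rfac b a (y, x) = sfac a b (x, y)"
  by (simp add: rfac_def sfac_def quot_swap)

text \<open>Everything follows from \<open>a x + b y - 1 = k x y\<close>. In the expansion of
  \<open>r s\<close> the bracket \<open>k x y - a x - b y\<close> equals -1, which leaves
  \<open>a b - k\<close>. Positivity comes from \<open>a x > 1\<close> and
  \<open>b y > 1\<close>.\<close>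

lemma sols_facts:
  assumes "a > 0" "b > 0" "(x, y) \<in> sols a b"
  defines "k \<equiv> quot a b (x, y)" and "r \<equiv> rfac a b (x, y)" and "s \<equiv> sfac a b (x, y)"
  shows "x > 1" "y > 1" "k > 0" "r > 0" "s > 0" "k * x = b + r" "k * y = a + s"
    "r * y = a * x - 1" "s * x = b * y - 1" "r * s = a * b - k"
proof -
  show x: "x > 1" and y: "y > 1"
    using assms(3) by (auto simp: sols_def)
  have k: "a * x + b * y - 1 = k * (x * y)"
    using assms(3) by (simp add: sols_def k_def quot_def)
  show kx: "k * x = b + r" and ky: "k * y = a + s"
    by (simp_all add: r_def s_def rfac_def sfac_def k_def)
  show ry: "r * y = a * x - 1"
    using k by (simp add: r_def rfac_def flip: k_def) (simp add: algebra_simps)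
  show sx: "s * x = b * y - 1"
    using k by (simp add: s_def sfac_def flip: k_def) (simp add: algebra_simps)
  have r': "r = k * x - b" and s': "s = k * y - a" using kx ky by simp_all
  have "r * s = k * (k * (x * y) - a * x - b * y) + a * b"
    unfolding r' s' by (simp add: algebra_simps)
  then show "r * s = a * b - k"
    unfolding k[symmetric] by simp
  have "a * x > 1" "b * y > 1"
    using assms(1,2) x y by (smt (verit) mult_less_cancel_right2)+
  then have "r * y > 0" "s * x > 0" "k * (x * y) > 0"
    using ry sx k by linarith+
  then show "r > 0" "s > 0" "k > 0"
    using x y by (auto intro: zero_less_mult_pos2)
qed

section \<open>Counting in residue classes\<close>

lemma finite_residue_class: "finite {i \<in> {1..N}. t dvd i - c}" for N :: int
  by (rule finite_subset[of _ "{1..N}"]) auto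

text \<open>Each block of \<open>t\<close> consecutive integers contains one member of the class, so
  the block number \<open>(i - 1) div t\<close> determines \<open>i\<close>.\<close>

lemma card_residue_class_le:
  fixes t N c :: int
  assumes "t > 0" "N \<ge> 0"
  shows "int (card {i \<in> {1..N}. t dvd i - c}) \<le> (N - 1) div t + 1"
proof -
  let ?C = "{i \<in> {1..N}. t dvd i - c}" and ?f = "\<lambda>i. (i - 1) div t"
  have "inj_on ?f ?C"
  proof (rule inj_onI)
    fix i j assume ij: "i \<in> ?C" "j \<in> ?C" "(i - 1) div t = (j - 1) div t"
    then have "t dvd (i - c) - (j - c)"
      by (simp only: dvd_diff mem_Collect_eq)
    then have "(i - 1) mod t = (j - 1) mod t"
      by (simp add: mod_eq_dvd_iff)
    then have "i - 1 = j - 1"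
      using ij(3) by (metis div_mult_mod_eq)
    then show "i = j" by simp
  qed
  moreover have "?f ` ?C \<subseteq> {0..(N - 1) div t}"
    using assms by (auto simp: pos_imp_zdiv_nonneg_iff intro!: zdiv_mono1)
  ultimately have "card ?C \<le> card {0..(N - 1) div t}"
    by (intro card_inj_on_le) auto
  \<comment> \<open>For \<open>N = 0\<close> the quotient is exactly -1, so the claimed bound is 0,
    matching the empty set.\<close>
  moreover have "(N - 1) div t \<ge> -1"
    using zdiv_mono1[of "-1" "N - 1" t] assms by (simp add: div_eq_minus1)
  ultimately show ?thesis by simp
qed

lemma card_residue_class_le_real:
  fixes t N c :: int
  assumes "t > 0" "N \<ge> 0"
  shows "real (card {i \<in> {1..N}. t dvd i - c}) \<le> (real_of_int N - 1) / t + 1"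
proof -
  have "real (card {i \<in> {1..N}. t dvd i - c}) \<le> real_of_int ((N - 1) div t + 1)"
    using card_residue_class_le[OF assms, of c] by linarith
  also have "\<dots> \<le> (real_of_int N - 1) / t + 1"
    using real_of_int_div4[of "N - 1" t] by simp
  finally show ?thesis .
qed

lemma card_Sigma_le:
  fixes c :: "'a \<Rightarrow> real"
  assumes "finite I" "\<And>i. i \<in> I \<Longrightarrow> finite (F i)" "\<And>i. i \<in> I \<Longrightarrow> real (card (F i)) \<le> c i"
  shows "real (card (Sigma I F)) \<le> sum c I"
proof -
  have "real (card (Sigma I F)) = (\<Sum>i\<in>I. real (card (F i)))"
    using assms by simp
  also have "\<dots> \<le> sum c I"
    using assms(3) by (rule sum_mono)
  finally show ?thesis .
qed

section \<open>Solutions with small quotient\<close>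

text \<open>The pair \<open>(r, k)\<close> determines the solution: \<open>k x = b + r\<close> gives
  \<open>x\<close>, then \<open>r y = a x - 1\<close> gives \<open>y\<close>. Since
  \<open>r s = a b - k\<close>, the value \<open>k\<close> lies in the class of \<open>a b\<close>
  modulo \<open>r\<close>. Summing the class counts over \<open>r\<close> yields the harmonic
  sum.\<close>

lemma card_small_quot_le:
  fixes K w :: real
  assumes ab: "a > 0" "b > 0" and "K \<ge> 0" "w \<ge> 1"
  shows "real (card {p \<in> sols a b. quot a b p \<le> K \<and> rfac a b p < w})
    \<le> (\<Sum>t\<in>{1..\<lceil>w\<rceil> - 1}. K / real_of_int t + 1)" (is "real (card ?A) \<le> _")
proof -
  let ?T = "SIGMA t:{1..\<lceil>w\<rceil> - 1}. {k \<in> {1..\<lfloor>K\<rfloor>}. t dvd k - a * b}"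
  let ?f = "\<lambda>p. (rfac a b p, quot a b p)"
  have "inj_on ?f ?A"
  proof (rule inj_onI, clarify)
    fix x y x' y'
    assume s: "(x, y) \<in> sols a b" "(x', y') \<in> sols a b"
      and e: "rfac a b (x, y) = rfac a b (x', y')" "quot a b (x, y) = quot a b (x', y')"
    note f = sols_facts[OF ab s(1)] and f' = sols_facts[OF ab s(2)]
    have "x = x'"
      using f(3,6) f'(6) e by (metis less_irrefl mult_cancel_left)
    moreover from this have "y = y'"
      using f(4,8) f'(8) e by (metis less_irrefl mult_cancel_left)
    ultimately show "x = x' \<and> y = y'" by simp
  qed
  moreover have "?f ` ?A \<subseteq> ?T"
  proof (rule image_subsetI)
    fix p assume p: "p \<in> ?A"
    obtain x y where xy: "p = (x, y)" by (cases p)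
    have s: "(x, y) \<in> sols a b" and le: "quot a b (x, y) \<le> K" "rfac a b (x, y) < w"
      using p unfolding xy by auto
    note f = sols_facts[OF ab s]
    have "rfac a b (x, y) dvd a * b - quot a b (x, y)"
      using f(10) by (metis dvd_triv_left)
    then have "rfac a b (x, y) dvd quot a b (x, y) - a * b"
      by (simp add: dvd_diff_commute)
    moreover have "rfac a b (x, y) \<le> \<lceil>w\<rceil> - 1" "quot a b (x, y) \<le> \<lfloor>K\<rfloor>"
      using le by linarith+
    ultimately show "?f p \<in> ?T"
      unfolding xy using f(3,4) by auto
  qed
  ultimately have "card ?A \<le> card ?T"
    by (intro card_inj_on_le finite_SigmaI finite_residue_class finite_atLeastAtMost_int)
  moreover have "real (card ?T) \<le> (\<Sum>t\<in>{1..\<lceil>w\<rceil> - 1}. K / real_of_int t + 1)"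
  proof (rule card_Sigma_le)
    fix t assume t: "t \<in> {1..\<lceil>w\<rceil> - 1}"
    then have "real (card {k \<in> {1..\<lfloor>K\<rfloor>}. t dvd k - a * b}) \<le> (real_of_int \<lfloor>K\<rfloor> - 1) / t + 1"
      using \<open>K \<ge> 0\<close> by (intro card_residue_class_le_real) auto
    also have "\<dots> \<le> K / t + 1"
      using t by (intro add_right_mono divide_right_mono) (auto, linarith)
    finally show "real (card {k \<in> {1..\<lfloor>K\<rfloor>}. t dvd k - a * b}) \<le> K / t + 1" .
  qed (rule finite_atLeastAtMost_int finite_residue_class)+
  ultimately show ?thesis by linarith
qed

lemma card_small_quot_le':
  fixes K w :: real
  assumes ab: "a > 0" "b > 0" and "K \<ge> 0" "w \<ge> 1"
  shows "real (card {p \<in> sols a b. quot a b p \<le> K \<and> sfac a b p < w})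
    \<le> (\<Sum>t\<in>{1..\<lceil>w\<rceil> - 1}. K / real_of_int t + 1)" (is "real (card ?A) \<le> _")
proof -
  have "?A = prod.swap ` {p \<in> sols b a. quot b a p \<le> K \<and> rfac b a p < w}"
    unfolding sols_swap[of a b]
    by (force simp: image_iff rfac_swap quot_swap[of b a])
  then have "card ?A = card {p \<in> sols b a. quot b a p \<le> K \<and> rfac b a p < w}"
    by (simp add: card_image)
  then show ?thesis
    using card_small_quot_le[OF ab(2,1) assms(3,4)] by simp
qed

section \<open>Solutions with large quotient\<close>

text \<open>The pair \<open>(x, r)\<close> determines \<open>y\<close> through
  \<open>r y = a x - 1\<close>, and \<open>k x = b + r\<close> puts \<open>r\<close> in the class of
  \<open>-b\<close> modulo \<open>x\<close>. As \<open>b + r < 2 w\<close> and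
  \<open>k > w / \<alpha>\<close>, only \<open>x < 2 \<alpha>\<close> occurs.\<close>

lemma card_large_quot_rfac_le:
  fixes \<alpha> w :: real
  assumes ab: "a > 0" "b > 0" and "\<alpha> \<ge> 1" "w \<ge> 1" "b \<le> w"
  shows "real (card {p \<in> sols a b. quot a b p > w / \<alpha> \<and> rfac a b p < w})
    \<le> (2 * \<alpha> - 1) * ((w + 1) / 2)" (is "real (card ?A) \<le> _")
proof -
  let ?T = "SIGMA x:{2..\<lceil>2 * \<alpha>\<rceil> - 1}. {r \<in> {1..\<lceil>w\<rceil> - 1}. x dvd r - (- b)}"
  let ?f = "\<lambda>p. (fst p, rfac a b p)"
  have "inj_on ?f ?A"
  proof (rule inj_onI, clarsimp)
    fix x y y'
    assume s: "(x, y) \<in> sols a b" "(x, y') \<in> sols a b"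
      and e: "rfac a b (x, y) = rfac a b (x, y')"
    note f = sols_facts[OF ab s(1)] and f' = sols_facts[OF ab s(2)]
    show "y = y'"
      using f(4,8) f'(8) e by (metis less_irrefl mult_cancel_left)
  qed
  moreover have "?f ` ?A \<subseteq> ?T"
  proof (rule image_subsetI)
    fix p assume p: "p \<in> ?A"
    obtain x y where xy: "p = (x, y)" by (cases p)
    have s: "(x, y) \<in> sols a b" and le: "quot a b (x, y) > w / \<alpha>" "rfac a b (x, y) < w"
      using p unfolding xy by auto
    note f = sols_facts[OF ab s]
    have "x dvd rfac a b (x, y) - (- b)"
      using f(6) by (metis add.commute diff_minus_eq_add dvd_triv_right)
    moreover have "x < 2 * \<alpha>"
    proof -
      have "w / \<alpha> * x < real_of_int (quot a b (x, y)) * x"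
        using le(1) f(1) by (intro mult_strict_right_mono) auto
      also have "\<dots> = real_of_int (b + rfac a b (x, y))"
        using f(6) by (metis of_int_mult)
      also have "\<dots> < 2 * w"
        using le \<open>b \<le> w\<close> by simp
      finally have "w * (x / \<alpha>) < w * 2" by (simp add: mult.commute)
      then have "x / \<alpha> < 2"
        by (rule mult_left_less_imp_less) (use \<open>w \<ge> 1\<close> in simp)
      then show ?thesis using \<open>\<alpha> \<ge> 1\<close> by (simp add: field_simps)
    qed
    then have "x \<le> \<lceil>2 * \<alpha>\<rceil> - 1" by linarith
    moreover have "rfac a b (x, y) \<le> \<lceil>w\<rceil> - 1"
      using le by linarith
    ultimately show "?f p \<in> ?T"
      unfolding xy using f(1,4) by auto
  qed
  ultimately have "card ?A \<le> card ?T"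
    by (intro card_inj_on_le finite_SigmaI finite_residue_class finite_atLeastAtMost_int)
  moreover have "real (card ?T) \<le> (\<Sum>x\<in>{2..\<lceil>2 * \<alpha>\<rceil> - 1}. (w + 1) / 2)"
  proof (rule card_Sigma_le)
    fix x assume x: "x \<in> {2..\<lceil>2 * \<alpha>\<rceil> - 1}"
    then have "real (card {r \<in> {1..\<lceil>w\<rceil> - 1}. x dvd r - (- b)})
        \<le> (real_of_int (\<lceil>w\<rceil> - 1) - 1) / x + 1"
      using \<open>w \<ge> 1\<close> by (intro card_residue_class_le_real) auto
    also have "\<dots> \<le> (w - 1) / x + 1"
      using x by (intro add_right_mono divide_right_mono) (auto, linarith)
    \<comment> \<open>The smallest modulus \<open>x = 2\<close> is the worst case; it bounds every
      fibre uniformly.\<close>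
    also have "\<dots> \<le> (w - 1) / 2 + 1"
      using x \<open>w \<ge> 1\<close> by (intro add_right_mono divide_left_mono) auto
    also have "\<dots> = (w + 1) / 2" by (simp add: field_simps)
    finally show "real (card {r \<in> {1..\<lceil>w\<rceil> - 1}. x dvd r - (- b)}) \<le> (w + 1) / 2" .
  qed (rule finite_atLeastAtMost_int finite_residue_class)+
  moreover have "(\<Sum>x\<in>{2..\<lceil>2 * \<alpha>\<rceil> - 1}. (w + 1) / 2) \<le> (2 * \<alpha> - 1) * ((w + 1) / 2)"
  proof -
    have "real (card {2..\<lceil>2 * \<alpha>\<rceil> - 1}) \<le> 2 * \<alpha> - 1"
      using \<open>\<alpha> \<ge> 1\<close> by simp linarith
    then show ?thesis using \<open>w \<ge> 1\<close> by (simp add: mult_right_mono)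
  qed
  ultimately show ?thesis by linarith
qed

text \<open>Now \<open>(y, s)\<close> determines \<open>x\<close>, and \<open>k y = a + s\<close>
  puts \<open>s\<close> in the class of \<open>-a\<close> modulo \<open>y\<close>. The range of
  \<open>y\<close> may be long when \<open>b\<close> is small, so the fibres must be bounded in
  terms of \<open>b\<close>: \<open>s x = b y - 1\<close> with \<open>x \<ge> 2\<close> leaves about
  \<open>b / 2\<close> values of \<open>s\<close> for each \<open>y\<close>.\<close>

lemma card_large_quot_sfac_le:
  fixes \<alpha> w :: real
  assumes ab: "a > 0" "b > 0" and "\<alpha> \<ge> 1" "w \<ge> 1" "b \<le> w" and w2: "w\<^sup>2 = a * b"
  shows "real (card {p \<in> sols a b. quot a b p > w / \<alpha> \<and> sfac a b p < w})
    \<le> \<alpha> * w + \<alpha> - 1" (is "real (card ?A) \<le> _")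
proof -
  define Y where "Y = \<alpha> * (w / b + 1)"
  let ?T = "SIGMA y:{2..\<lceil>Y\<rceil> - 1}. {s \<in> {1..(b * y - 1) div 2}. y dvd s - (- a)}"
  let ?f = "\<lambda>p. (snd p, sfac a b p)"
  have "inj_on ?f ?A"
  proof (rule inj_onI, clarsimp)
    fix x y x'
    assume s: "(x, y) \<in> sols a b" "(x', y) \<in> sols a b"
      and e: "sfac a b (x, y) = sfac a b (x', y)"
    note f = sols_facts[OF ab s(1)] and f' = sols_facts[OF ab s(2)]
    show "x = x'"
      using f(5,9) f'(9) e by (metis less_irrefl mult_cancel_left)
  qed
  moreover have "?f ` ?A \<subseteq> ?T"
  proof (rule image_subsetI)
    fix p assume p: "p \<in> ?A"
    obtain x y where xy: "p = (x, y)" by (cases p)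
    have s: "(x, y) \<in> sols a b" and le: "quot a b (x, y) > w / \<alpha>" "sfac a b (x, y) < w"
      using p unfolding xy by auto
    note f = sols_facts[OF ab s]
    have "y dvd sfac a b (x, y) - (- a)"
      using f(7) by (metis add.commute diff_minus_eq_add dvd_triv_right)
    moreover have "y < Y"
    proof -
      have aw: "real_of_int a = w * (w / b)"
        using w2 ab by (simp add: field_simps power2_eq_square)
      have "w / \<alpha> * y < real_of_int (quot a b (x, y)) * y"
        using le(1) f(2) by (intro mult_strict_right_mono) auto
      also have "\<dots> = real_of_int (a + sfac a b (x, y))"
        using f(7) by (metis of_int_mult)
      also have "\<dots> < w * (w / b + 1)"
        using le aw by (simp add: distrib_left)
      finally have "w * (y / \<alpha>) < w * (w / b + 1)" by (simp add: mult.commute)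
      then have "y / \<alpha> < w / b + 1"
        by (rule mult_left_less_imp_less) (use \<open>w \<ge> 1\<close> in simp)
      then show ?thesis using \<open>\<alpha> \<ge> 1\<close> by (simp add: pos_divide_less_eq Y_def mult.commute)
    qed
    then have "y \<le> \<lceil>Y\<rceil> - 1" by linarith
    moreover have "sfac a b (x, y) * 2 \<le> sfac a b (x, y) * x"
      using f(1,5) by (intro mult_left_mono) auto
    then have "sfac a b (x, y) \<le> (b * y - 1) div 2"
      using f(9) by linarith
    ultimately show "?f p \<in> ?T"
      unfolding xy using f(2,5) by auto
  qed
  ultimately have "card ?A \<le> card ?T"
    by (intro card_inj_on_le finite_SigmaI finite_residue_class finite_atLeastAtMost_int)
  moreover have "real (card ?T) \<le> (\<Sum>y\<in>{2..\<lceil>Y\<rceil> - 1}. (real_of_int b + 1) / 2)"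
  proof (rule card_Sigma_le)
    fix y assume y: "y \<in> {2..\<lceil>Y\<rceil> - 1}"
    define N where "N = (b * y - 1) div 2"
    have b_y: "b * y > 0" using ab y by simp
    then have N: "N \<ge> 0" "2 * N \<le> b * y - 1" unfolding N_def by linarith+
    \<comment> \<open>With \<open>q = (N - 1) div y\<close>, this gives \<open>2 q y < b y\<close>,
      hence \<open>2 q < b\<close>. Integrality then yields \<open>2 (q + 1) \<le> b + 1\<close>,
      independent of \<open>y\<close>.\<close>
    have "y * ((N - 1) div y) \<le> N - 1"
      using y by (smt (verit) atLeastAtMost_iff mult_div_mod_eq pos_mod_sign)
    then have "y * (2 * ((N - 1) div y)) < y * b"
      using N by (simp add: mult.commute)
    then have "2 * ((N - 1) div y) < b" using y by simp
    moreover have "int (card {s \<in> {1..N}. y dvd s - (- a)}) \<le> (N - 1) div y + 1"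
      using y N by (intro card_residue_class_le) auto
    ultimately have "2 * int (card {s \<in> {1..N}. y dvd s - (- a)}) \<le> b + 1"
      by linarith
    then have "real_of_int (2 * int (card {s \<in> {1..N}. y dvd s - (- a)})) \<le> real_of_int (b + 1)"
      by (simp only: of_int_le_iff)
    then show "real (card {s \<in> {1..(b * y - 1) div 2}. y dvd s - (- a)}) \<le> (real_of_int b + 1) / 2"
      unfolding N_def by simp
  qed (rule finite_atLeastAtMost_int finite_residue_class)+
  moreover have "(\<Sum>y\<in>{2..\<lceil>Y\<rceil> - 1}. (real_of_int b + 1) / 2) \<le> (Y - 1) * ((real_of_int b + 1) / 2)"
  proof -
    have "1 * 2 \<le> Y"
      unfolding Y_def using assms by (intro mult_mono) auto
    then have "real (card {2..\<lceil>Y\<rceil> - 1}) \<le> Y - 1"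
      by simp linarith
    then show ?thesis using ab by (simp add: mult_right_mono)
  qed
  moreover have "(Y - 1) * ((real_of_int b + 1) / 2) \<le> \<alpha> * w + \<alpha> - 1"
  proof -
    \<comment> \<open>The slack factors into terms that are nonnegative because
      \<open>1 \<le> b \<le> w\<close>.\<close>
    have "2 * (\<alpha> * w + \<alpha> - 1 - (Y - 1) * ((real_of_int b + 1) / 2))
        = \<alpha> * ((b - 1) * (w / b - 1)) + (real_of_int b - 1)"
      using ab by (simp add: Y_def field_simps)
    also have "\<dots> \<ge> 0"
      using assms by (intro add_nonneg_nonneg mult_nonneg_nonneg) auto
    finally show ?thesis by simp
  qed
  ultimately show ?thesis by linarith
qed

section \<open>Harmonic sums and the logarithm\<close>

text \<open>The left side is the first term of the power series of the right side; the difference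
  vanishes at 0 and has a nonnegative derivative.\<close>

lemma ln_ratio_ge:
  fixes u :: real
  assumes "0 \<le> u" "u < 1"
  shows "2 * u \<le> ln ((1 + u) / (1 - u))"
proof -
  let ?g = "\<lambda>u. ln (1 + u) - ln (1 - u) - 2 * u :: real"
  have "?g 0 \<le> ?g u"
  proof (rule DERIV_nonneg_imp_nondecreasing[OF assms(1)])
    fix x :: real assume x: "0 \<le> x" "x \<le> u"
    have "(?g has_real_derivative (1 / (1 + x) + 1 / (1 - x) - 2)) (at x)"
      using x assms by (auto intro!: derivative_eq_intros)
    moreover have "1 / (1 + x) + 1 / (1 - x) - 2 = 2 * x\<^sup>2 / ((1 + x) * (1 - x))"
      using x assms by (simp add: divide_simps) (simp add: algebra_simps power2_eq_square)
    moreover have "\<dots> \<ge> 0"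
      using x assms by simp
    ultimately show "\<exists>y. (?g has_real_derivative y) (at x) \<and> 0 \<le> y"
      by metis
  qed
  then show ?thesis using assms by (simp add: ln_div)
qed

text \<open>The shift by 1/2 makes the logarithms telescope: for \<open>u = 1 / (2 (m + 1))\<close>
  the ratio \<open>(1 + u) / (1 - u)\<close> is \<open>(m + 3/2) / (m + 1/2)\<close>, and
  \<open>2 u = 1 / (m + 1)\<close>.\<close>

lemma harmonic_sum_le:
  assumes "m \<ge> (1 :: int)"
  shows "(\<Sum>t\<in>{1..m}. 1 / real_of_int t) \<le> ln (m + 1 / 2) + 0.6"
  using assms
proof (induction m rule: int_ge_induct)
  case base
  \<comment> \<open>The ratio is 3/2, so \<open>ln (3/2) \<ge> 0.4\<close>; this is where the
    constant 0.6 comes from.\<close>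
  have "2 * (1 / 5) \<le> ln ((1 + 1 / 5) / (1 - 1 / 5 :: real))"
    by (rule ln_ratio_ge) auto
  then show ?case by simp
next
  case (step m)
  define u where "u = 1 / (2 * (real_of_int m + 1))"
  have "1 / (real_of_int m + 1) = 2 * u"
    using step(1) by (simp add: u_def field_simps)
  also have "\<dots> \<le> ln ((1 + u) / (1 - u))"
    using step(1) by (intro ln_ratio_ge) (auto simp: u_def)
  also have "(1 + u) / (1 - u) = (m + 1 + 1 / 2) / (m + 1 / 2)"
  proof -
    have "1 + u = (m + 1 + 1 / 2) / (m + 1)" "1 - u = (m + 1 / 2) / (m + 1)"
      using step(1) by (simp_all add: u_def field_simps)
    then show ?thesis using step(1) by simp
  qed
  also have "ln \<dots> = ln (m + 1 + 1 / 2) - ln (m + 1 / 2)"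
    using step(1) by (simp add: ln_div)
  finally have "1 / (real_of_int m + 1) \<le> ln (m + 1 + 1 / 2) - ln (m + 1 / 2)" .
  moreover have "{1..m + 1} = insert (m + 1) {1..m}"
    using step(1) by auto
  ultimately show ?case
    using step(2) by (simp add: add.commute)
qed

section \<open>Comparison of the collected terms with the claimed bound\<close>

text \<open>
  Here \<open>m\<close> stands for the largest integer below \<open>w = sqrt n\<close>. For \<open>n = 2, 3\<close> the slack in the terms
  without \<open>m\<close> does not suffice, and the gap between \<open>m = 1\<close> and \<open>w\<close> has to compensate.
\<close>

lemma sum_of_bounds_less:
  fixes \<alpha> w m :: real
  assumes "1 \<le> \<alpha>" "\<alpha> \<le> w" "m < w" and w: "w \<ge> 2 \<or> m = 1 \<and> w \<ge> 1.4"
  shows "2 / \<alpha> * (m + 1 / 2 - w) + 2 * m + (2 * \<alpha> - 1) * ((w + 1) / 2) + (\<alpha> * w + \<alpha> - 1)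
    < 2 * w + 2 * (2 * w\<^sup>2 - 1) * \<alpha> / (2 * w - \<alpha>)"
proof -
  have pos: "\<alpha> > 0" "w > 0" "2 * w - \<alpha> > 0" using assms by auto
  \<comment> \<open>Polynomial division in \<open>\<alpha>\<close> replaces the fraction by a lower
    bound without the denominator \<open>2 w - \<alpha>\<close>; the remainder is nonnegative since
    \<open>\<alpha> \<ge> 1 / w\<close>.\<close>
  have "2 * (2 * w\<^sup>2 - 1) * \<alpha> / (2 * w - \<alpha>) - (2 * \<alpha> * w + (\<alpha>\<^sup>2 - \<alpha> / w))
      = \<alpha>\<^sup>2 * (\<alpha> - 1 / w) / (2 * w - \<alpha>)"
    using pos by (simp add: field_simps power2_eq_square)
  moreover have "1 / w \<le> \<alpha>"
    using assms mult_mono[of 1 \<alpha> 1 w] by (simp add: field_simps)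
  ultimately have *: "2 * \<alpha> * w + (\<alpha>\<^sup>2 - \<alpha> / w) \<le> 2 * (2 * w\<^sup>2 - 1) * \<alpha> / (2 * w - \<alpha>)"
    using pos by (smt (verit) divide_nonneg_pos mult_nonneg_nonneg zero_le_power2)
  have lhs: "(2 * \<alpha> - 1) * ((w + 1) / 2) + (\<alpha> * w + \<alpha> - 1)
      = 2 * \<alpha> * w + 2 * \<alpha> - w / 2 - 3 / 2"
    by (simp add: field_simps)
  have "2 / \<alpha> * (m + 1 / 2 - w) + 2 * (m - w) < \<alpha>\<^sup>2 - \<alpha> / w - 2 * \<alpha> + w / 2 + 3 / 2"
    using w
  proof
    assume w2: "w \<ge> 2"
    have "2 / \<alpha> * (m + 1 / 2 - w) \<le> 2 / \<alpha> * (1 / 2)"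
      using assms pos by (intro mult_left_mono) auto
    moreover have "2 * (m - w) < 0" using assms by simp
    moreover have "1 / \<alpha> \<le> \<alpha>\<^sup>2 - \<alpha> / w - 2 * \<alpha> + w / 2 + 3 / 2"
    proof -
      have "\<alpha> / w \<le> \<alpha> / 2" using w2 pos by (intro divide_left_mono) auto
      \<comment> \<open>The left side decreases in \<open>w\<close>, so \<open>w = 2\<close> is
        extremal. What remains is a cubic in \<open>\<alpha>\<close> with root 1.\<close>
      have e: "\<alpha> / w - w / 2 \<le> \<alpha> / 2 - 1"
        using w2 \<open>\<alpha> / w \<le> \<alpha> / 2\<close> by linarith
      have "(\<alpha>\<^sup>2 - 5 / 2 * \<alpha> + 5 / 2) * \<alpha> - 1 = (\<alpha> - 1) * ((\<alpha> - 3/4)\<^sup>2 + 7/16)"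
        by (simp add: field_simps power2_eq_square)
      also have "\<dots> \<ge> 0" using assms by (intro mult_nonneg_nonneg add_nonneg_nonneg) auto
      finally have "1 / \<alpha> \<le> \<alpha>\<^sup>2 - 5 / 2 * \<alpha> + 5 / 2"
        using pos by (simp add: pos_divide_le_eq)
      then show ?thesis using e by linarith
    qed
    ultimately show ?thesis by simp
  next
    assume w1: "m = 1 \<and> w \<ge> 1.4"
    have "2 / \<alpha> * (m + 1 / 2 - w) \<le> 2 / \<alpha> * (1 / 10)"
      using w1 pos by (intro mult_left_mono) auto
    also have "\<dots> \<le> 2 / 10"
      using assms pos by (simp add: field_simps)
    finally have "2 / \<alpha> * (m + 1 / 2 - w) + 2 * (m - w) \<le> 2 / 10 + - 8 / 10"
      using w1 by (intro add_mono) auto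
    moreover have "\<alpha> / w \<le> \<alpha> / (7 / 5)" using w1 pos by (intro divide_left_mono) auto
    \<comment> \<open>Completing the square: the coefficient of \<open>\<alpha>\<close> is
      \<open>-(2 + 5/7) = -19/7\<close>.\<close>
    moreover have "(\<alpha> - 19/14)\<^sup>2 = \<alpha>\<^sup>2 - 2 * \<alpha> - \<alpha> / (7 / 5) + (19/14)\<^sup>2"
      by (simp add: algebra_simps power2_eq_square)
    moreover have "(\<alpha> - 19/14)\<^sup>2 \<ge> 0" "(19/14 :: real)\<^sup>2 < 37 / 20" by (simp_all add: power2_eq_square)
    moreover have "w \<ge> 7 / 5" using w1 by simp
    ultimately show ?thesis by linarith
  qed
  then show ?thesis using * lhs by (smt (verit))
qed

section \<open>Assembling the four counts\<close>

lemma rho'_less_ordered: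
  fixes a b n :: int and \<alpha> :: real
  assumes ab: "a > 0" "b > 0" "b \<le> a" and n: "n = a * b"
    and \<alpha>: "1 \<le> \<alpha>" "\<alpha> \<le> sqrt n"
  shows "real (rho' a b) <
    1 / \<alpha> * sqrt n * ln n + 2 * (1 + 0.6 / \<alpha>) * sqrt n
      + 2 * (2 * n - 1) * \<alpha> / (2 * sqrt n - \<alpha>)"
proof (cases "n = 1")
  case True
  \<comment> \<open>Here \<open>r s = 1 - k \<le> 0\<close>, although \<open>r\<close> and
    \<open>s\<close> are positive.\<close>
  have "sols a b = {}"
  proof (rule ccontr)
    assume "sols a b \<noteq> {}"
    then obtain x y where s: "(x, y) \<in> sols a b" by auto
    note f = sols_facts[OF ab(1,2) s]
    have "rfac a b (x, y) * sfac a b (x, y) > 0"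
      using f(4,5) by simp
    then show False using f(3,10) True n by linarith
  qed
  then show ?thesis using True \<alpha> by (simp add: rho'_sols)
next
  case False
  then have n2: "n \<ge> 2" using ab n by (smt (verit) mult_pos_pos)
  define w where "w = sqrt n"
  define K where "K = w / \<alpha>"
  \<comment> \<open>The largest integer strictly below \<open>w\<close>, also when \<open>w\<close>
    is an integer.\<close>
  define m where "m = \<lceil>w\<rceil> - 1"
  have ww: "w\<^sup>2 = n" using n2 by (simp add: w_def)
  have w1: "w > 1" using n2 by (simp add: w_def)
  have w14: "w \<ge> 1.4" unfolding w_def using n2
    by (intro real_le_rsqrt) (auto simp: power2_eq_square)
  have m: "m \<ge> 1" "m < w" "w \<le> real_of_int m + 1" using w1 unfolding m_def by linarith+
  have K: "K \<ge> 0" using w1 \<alpha> by (simp add: K_def)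
  have "b * b \<le> n" using ab n by (simp add: mult_right_mono)
  then have bw: "b \<le> w"
    unfolding w_def by (intro real_le_rsqrt) (simp add: power2_eq_square flip: of_int_mult)
  let ?A = "{p \<in> sols a b. quot a b p \<le> K \<and> rfac a b p < w}"
  let ?A' = "{p \<in> sols a b. quot a b p \<le> K \<and> sfac a b p < w}"
  let ?B = "{p \<in> sols a b. quot a b p > w / \<alpha> \<and> rfac a b p < w}"
  let ?B' = "{p \<in> sols a b. quot a b p > w / \<alpha> \<and> sfac a b p < w}"
  \<comment> \<open>Otherwise \<open>r s \<ge> w * w = n\<close>, contradicting
    \<open>r s = n - k < n\<close>.\<close>
  have rs: "rfac a b p < w \<or> sfac a b p < w" if "p \<in> sols a b" for p
  proof (rule ccontr)
    assume neg: "\<not> ?thesis"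
    obtain x y where p: "p = (x, y)" by (cases p)
    note f = sols_facts[OF ab(1,2) that[unfolded p], folded p]
    have "w * w \<le> real_of_int (rfac a b p) * real_of_int (sfac a b p)"
      using neg w1 by (intro mult_mono) auto
    also have "\<dots> = real_of_int (a * b - quot a b p)"
      using f(10) by (metis of_int_mult)
    also have "\<dots> < n" using f(3) n by simp
    finally show False using ww by (simp add: power2_eq_square)
  qed
  have "sols a b \<subseteq> (?A \<union> ?A') \<union> (?B \<union> ?B')"
    using rs by (auto simp: K_def)
  then have "card (sols a b) \<le> card ((?A \<union> ?A') \<union> (?B \<union> ?B'))"
    using finite_sols[OF ab(1,2)] by (intro card_mono) auto
  also have "\<dots> \<le> card (?A \<union> ?A') + card (?B \<union> ?B')" by (rule card_Un_le)
  also have "\<dots> \<le> (card ?A + card ?A') + (card ?B + card ?B')"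
    by (intro add_mono card_Un_le)
  finally have "real (rho' a b) \<le> real (card ?A) + real (card ?A') + real (card ?B) + real (card ?B')"
    unfolding rho'_sols by linarith
  also have "\<dots> \<le> 2 * (\<Sum>t\<in>{1..m}. K / real_of_int t + 1)
      + (2 * \<alpha> - 1) * ((w + 1) / 2) + (\<alpha> * w + \<alpha> - 1)"
    using card_small_quot_le[OF ab(1,2) K, of w] card_small_quot_le'[OF ab(1,2) K, of w]
      card_large_quot_rfac_le[OF ab(1,2) \<alpha>(1) _ bw] card_large_quot_sfac_le[OF ab(1,2) \<alpha>(1) _ bw]
      w1 ww n
    unfolding m_def by simp
  also have "(\<Sum>t\<in>{1..m}. K / real_of_int t + 1) = K * (\<Sum>t\<in>{1..m}. 1 / real_of_int t) + m"
    using m by (simp add: sum.distrib sum_distrib_left)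
  also have "\<dots> \<le> K * (ln w + (m + 1 / 2 - w) / w + 0.6) + m"
  proof -
    \<comment> \<open>The tangent to \<open>ln\<close> at \<open>w\<close> keeps the term
      \<open>m + 1/2 - w\<close>, whose size matters when \<open>w < 2\<close>; multiplied by
      \<open>K = w / \<alpha>\<close> it loses the denominator \<open>w\<close>.\<close>
    have "ln (m + 1 / 2) - ln w \<le> (m + 1 / 2 - w) / w"
      using m w1 by (intro ln_diff_le) auto
    then show ?thesis
      using harmonic_sum_le[OF m(1)] K by (intro add_right_mono mult_left_mono) auto
  qed
  also have "K * (ln w + (m + 1 / 2 - w) / w + 0.6)
      = 1 / \<alpha> * w * ln w + 1 / \<alpha> * (m + 1 / 2 - w) + 0.6 / \<alpha> * w"
    using w1 \<alpha> by (simp add: K_def field_simps)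
  \<comment> \<open>The factor 1/2 cancels against the two harmonic sums, one for \<open>r\<close>
    and one for \<open>s\<close>.\<close>
  also have "ln w = ln n / 2"
    using n2 by (simp add: w_def ln_sqrt)
  finally have "real (rho' a b) \<le> 1 / \<alpha> * w * ln n + 2 * (0.6 / \<alpha>) * w
      + (2 / \<alpha> * (m + 1 / 2 - w) + 2 * real_of_int m
        + (2 * \<alpha> - 1) * ((w + 1) / 2) + (\<alpha> * w + \<alpha> - 1))"
    by (simp add: algebra_simps)
  also have "\<dots> < 1 / \<alpha> * w * ln n + 2 * (0.6 / \<alpha>) * w
      + (2 * w + 2 * (2 * w\<^sup>2 - 1) * \<alpha> / (2 * w - \<alpha>))"
  proof (intro add_strict_left_mono sum_of_bounds_less)
    show "w \<ge> 2 \<or> real_of_int m = 1 \<and> w \<ge> 1.4"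
      using m w14 by (cases "m = 1") auto
  qed (use \<alpha> m in \<open>auto simp: w_def\<close>)
  also have "\<dots> = 1 / \<alpha> * w * ln n + 2 * (1 + 0.6 / \<alpha>) * w
      + 2 * (2 * n - 1) * \<alpha> / (2 * w - \<alpha>)"
    unfolding ww by (simp add: algebra_simps)
  finally show ?thesis by (simp add: w_def)
qed

theorem theorem1:
  fixes a b n :: int and \<alpha> :: real
  assumes "a > 0" and "b > 0" and "n = a * b" and "n \<ge> 1"
    and "1 \<le> \<alpha>" and "\<alpha> \<le> sqrt n"
  shows "real (rho' a b) <
    1 / \<alpha> * sqrt n * ln n + 2 * (1 + 0.6 / \<alpha>) * sqrt n
      + 2 * (2 * n - 1) * \<alpha> / (2 * sqrt n - \<alpha>)"
proof (cases "b \<le> a")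
  case True
  then show ?thesis using assms by (intro rho'_less_ordered) auto
next
  case False
  then have "real (rho' b a) <
    1 / \<alpha> * sqrt n * ln n + 2 * (1 + 0.6 / \<alpha>) * sqrt n
      + 2 * (2 * n - 1) * \<alpha> / (2 * sqrt n - \<alpha>)"
    using assms by (intro rho'_less_ordered) (auto simp: mult.commute)
  then show ?thesis by (simp add: rho'_commute)
qed

end
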